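(* Let $m>n$, let $X\subset\mathbb{R}^m$ and $Y\subset\mathbb{R}^n$ be nonempty, open and bounded, and suppose that $b:\overline X\times\overline Y\to\mathbb{R}$ satisfies (B0) and (B1) (defined in the context). Then one of the following holds. 1. $U_{b,\phi}$ is not convex. 2. The space of types can be reduced to an $n$-dimensional space of effective types, and solving the monopolist's problem with this effective space of types is equivalent to solving her original problem. That is, for fixed $y_0\in Y$, with $Q(x)=D_yb(x,y_0)$ and $Z=Q(X)\subseteq\mathbb{R}^n$, the effective preference function $h(z,y)=b(x,y)-b(x,y_0)$ (for any $x\in X$ with $Q(x)=z$) is well defined on $Z\times\overline Y$, and for every price schedule $v$ one has $v^b(x)=v^h(Q(x))+b(x,y_0)$ for all $x\in X$; for each $x\in X$ the goods maximizing $b(x,\cdot)-v$ are exactly those maximizing $h(Q(x),\cdot)-v$; and $P(v^b)=P_{eff}(v^h)$.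
   Context: (B0): $b\in C^4(\overline X\times\overline Y)$. (B1): for all $x_0\in\overline X$, $y_0\in\overline Y$, the level sets of the maps $y\mapsto D_xb(x_0,y)$ and $x\mapsto D_yb(x,y_0)$ are connected (both when the maps are considered on $Y$, $X$ and on $\overline Y$, $\overline X$), and the $m\times n$ matrix $D^2_{xy}b(x_0,y_0)$ of mixed second partial derivatives has full rank. $c:\overline Y\to\mathbb{R}$ is the production cost, $y_\phi\in\overline Y$ is fixed, and $\mu$ is the distribution of types on $X$, given by a density. A price schedule is a function $v:\overline Y\to\mathbb{R}\cup\{+\infty\}$, with utility $v^b(x)=\sup_{y\in\overline Y}(b(x,y)-v(y))$. Finite-valued functions on $X$ of the form $v^b$ are called $b$-convex, and $U_{b,\phi}$ is the set of $b$-convex functions $u$ with $u(x)\ge b(x,y_\phi)-c(y_\phi)$ for all $x\in X$. A good chosen by type $x$ is $y_{v^b}(x)\in\operatorname{argmax}_{y\in\overline Y}(b(x,y)-v(y))$, and the monopolist's profit is $P(v^b)=\int_X\big(b(x,y_{v^b}(x))-v^b(x)-c(y_{v^b}(x))\big)\,d\mu(x)$. On the effective side, $v^h(z)=\sup_{y\in\overline Y}(h(z,y)-v(y))$ for $z\in Z$, $y_{v^h}(z)\in\operatorname{argmax}_{y\in\overline Y}(h(z,y)-v(y))$, $\nu=Q_\#\mu$ is the pushforward measure, and $P_{eff}(v^h)=\int_Z\big(h(z,y_{v^h}(z))-v^h(z)-c(y_{v^h}(z))\big)\,d\nu(z)$. The choices are made consistently, $y_{v^b}=y_{v^h}\circ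 Q$. In the assertions about profits, $v$ is such that the utilities are finite, the maximizers exist and the integrals are well defined. *)

theory Defs
  imports "HOL-Probability.Probability"
begin

text \<open>
  For open \<open>S\<close>, \<open>C\<^sup>k\<close> on the closure of \<open>S\<close> is taken in the usual sense: \<open>f\<close> is continuous on the
  closure, and its partial derivatives up to order \<open>k\<close> exist in \<open>S\<close> and extend continuously to the
  closure. The field \<open>g\<close> below is the gradient of \<open>f\<close> in \<open>S\<close> and its continuous extension on the
  boundary.
\<close>

primrec Ck_on_closure :: "nat \<Rightarrow> 'a::euclidean_space set \<Rightarrow> ('a \<Rightarrow> real) \<Rightarrow> bool" where
  "Ck_on_closure 0 S f \<longleftrightarrow> continuous_on (closure S) f"
| "Ck_on_closure (Suc k) S f \<longleftrightarrow> continuous_on (closure S) f \<and>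
     (\<exists>g. (\<forall>p\<in>S. GDERIV f p :> g p) \<and> (\<forall>i\<in>Basis. Ck_on_closure k S (\<lambda>p. g p \<bullet> i)))"

definition grad :: "('a::real_inner \<Rightarrow> real) \<Rightarrow> 'a \<Rightarrow> 'a" where
  "grad f x = (THE d. GDERIV f x :> d)"

text \<open>Derivatives at boundary points are understood as limits of the derivatives in the interior.\<close>

definition boundary_ext :: "'a::topological_space set \<Rightarrow> ('a \<Rightarrow> 'b::t2_space) \<Rightarrow> 'a \<Rightarrow> 'b" where
  "boundary_ext S g p = (if p \<in> S then g p else Lim (at p within S) g)"

definition D_x :: "(real^'m) set \<Rightarrow> (real^'n) set \<Rightarrow> (real^'m \<Rightarrow> real^'n \<Rightarrow> real)
    \<Rightarrow> real^'m \<Rightarrow> real^'n \<Rightarrow> real^'m" where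
  "D_x X Y b x y = boundary_ext (X \<times> Y) (\<lambda>(x, y). grad (\<lambda>x'. b x' y) x) (x, y)"

definition D_y :: "(real^'m) set \<Rightarrow> (real^'n) set \<Rightarrow> (real^'m \<Rightarrow> real^'n \<Rightarrow> real)
    \<Rightarrow> real^'m \<Rightarrow> real^'n \<Rightarrow> real^'n" where
  "D_y X Y b x y = boundary_ext (X \<times> Y) (\<lambda>(x, y). grad (\<lambda>y'. b x y') y) (x, y)"

text \<open>The matrix with \<open>m\<close> rows and \<open>n\<close> columns whose \<open>(i, j)\<close> entry is
  \<open>\<partial>\<^sup>2b / \<partial>x\<^sub>i\<partial>y\<^sub>j\<close>.\<close>

definition D2_xy :: "(real^'m) set \<Rightarrow> (real^'n) set \<Rightarrow> (real^'m \<Rightarrow> real^'n \<Rightarrow> real)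
    \<Rightarrow> real^'m \<Rightarrow> real^'n \<Rightarrow> real^'n^'m" where
  "D2_xy X Y b x y =
     boundary_ext (X \<times> Y) (\<lambda>(x, y). jacobian (\<lambda>y'. grad (\<lambda>x'. b x' y') x) (at y)) (x, y)"

definition B0 :: "(real^'m) set \<Rightarrow> (real^'n) set \<Rightarrow> (real^'m \<Rightarrow> real^'n \<Rightarrow> real) \<Rightarrow> bool" where
  "B0 X Y b \<longleftrightarrow> Ck_on_closure 4 (X \<times> Y) (\<lambda>(x, y). b x y)"

definition B1 :: "(real^'m) set \<Rightarrow> (real^'n) set \<Rightarrow> (real^'m \<Rightarrow> real^'n \<Rightarrow> real) \<Rightarrow> bool" where
  "B1 X Y b \<longleftrightarrow> (\<forall>x0\<in>closure X. \<forall>y0\<in>closure Y.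
     (\<forall>p. connected {y \<in> Y. D_x X Y b x0 y = p} \<and>
          connected {y \<in> closure Y. D_x X Y b x0 y = p}) \<and>
     (\<forall>q. connected {x \<in> X. D_y X Y b x y0 = q} \<and>
          connected {x \<in> closure X. D_y X Y b x y0 = q}) \<and>
     rank (D2_xy X Y b x0 y0) = min CARD('m) CARD('n))"

definition price_schedule :: "(real^'n) set \<Rightarrow> (real^'n \<Rightarrow> ereal) \<Rightarrow> bool" where
  "price_schedule Y v \<longleftrightarrow> (\<forall>y\<in>closure Y. v y \<noteq> -\<infinity>)"

text \<open>The following notions serve both the original preference function \<open>b\<close> on types \<open>x\<close> and the
  effective preference function \<open>h\<close> on effective types \<open>z\<close>.\<close>

definition indirect_utility :: "(real^'n) set \<Rightarrow> ('t \<Rightarrow> real^'n \<Rightarrow> real) \<Rightarrow> (real^'n \<Rightarrow> ereal)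
    \<Rightarrow> 't \<Rightarrow> ereal" where
  "indirect_utility Y b v x = (SUP y\<in>closure Y. ereal (b x y) - v y)"

definition optimal_goods :: "(real^'n) set \<Rightarrow> ('t \<Rightarrow> real^'n \<Rightarrow> real) \<Rightarrow> (real^'n \<Rightarrow> ereal)
    \<Rightarrow> 't \<Rightarrow> (real^'n) set" where
  "optimal_goods Y b v x =
     {y. is_arg_max (\<lambda>y. ereal (b x y) - v y) (\<lambda>y. y \<in> closure Y) y}"

definition profit_integrand :: "(real^'n) set \<Rightarrow> ('t \<Rightarrow> real^'n \<Rightarrow> real) \<Rightarrow> (real^'n \<Rightarrow> real)
    \<Rightarrow> (real^'n \<Rightarrow> ereal) \<Rightarrow> ('t \<Rightarrow> real^'n) \<Rightarrow> 't \<Rightarrow> real" where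
  "profit_integrand Y b c v good x =
     b x (good x) - real_of_ereal (indirect_utility Y b v x) - c (good x)"

definition profit :: "'t measure \<Rightarrow> (real^'n) set \<Rightarrow> ('t \<Rightarrow> real^'n \<Rightarrow> real) \<Rightarrow> (real^'n \<Rightarrow> real)
    \<Rightarrow> (real^'n \<Rightarrow> ereal) \<Rightarrow> ('t \<Rightarrow> real^'n) \<Rightarrow> real" where
  "profit M Y b c v good = (LINT x|M. profit_integrand Y b c v good x)"

text \<open>A function on \<open>X\<close> is represented by a total function whose values outside \<open>X\<close> are
  unconstrained.\<close>

definition b_convex :: "'t set \<Rightarrow> (real^'n) set \<Rightarrow> ('t \<Rightarrow> real^'n \<Rightarrow> real) \<Rightarrow> ('t \<Rightarrow> real) \<Rightarrow> bool"
  where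
  "b_convex X Y b u \<longleftrightarrow>
     (\<exists>v. price_schedule Y v \<and> (\<forall>x\<in>X. ereal (u x) = indirect_utility Y b v x))"

definition U_b_phi :: "'t set \<Rightarrow> (real^'n) set \<Rightarrow> ('t \<Rightarrow> real^'n \<Rightarrow> real) \<Rightarrow> (real^'n \<Rightarrow> real)
    \<Rightarrow> real^'n \<Rightarrow> ('t \<Rightarrow> real) set" where
  "U_b_phi X Y b c y\<phi> = {u. b_convex X Y b u \<and> (\<forall>x\<in>X. u x \<ge> b x y\<phi> - c y\<phi>)}"

text \<open>The function type is no instance of \<open>real_vector\<close>, so this spells out \<^const>\<open>convex\<close>
  with pointwise operations.\<close>

definition convex_functions :: "('t \<Rightarrow> real) set \<Rightarrow> bool" where
  "convex_functions U \<longleftrightarrow> (\<forall>u\<in>U. \<forall>w\<in>U. \<forall>s\<ge>0. \<forall>t\<ge>0. s + t = 1 \<longrightarrow> (\<lambda>x. s * u x + t * w x) \<in> U)"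

definition effective_preference :: "'s set \<Rightarrow> ('s \<Rightarrow> 't) \<Rightarrow> ('s \<Rightarrow> 'y \<Rightarrow> real) \<Rightarrow> 'y \<Rightarrow> 't \<Rightarrow> 'y \<Rightarrow> real"
  where
  "effective_preference X Q b y0 z y =
     (let x = (SOME x. x \<in> X \<and> Q x = z) in b x y - b x y0)"

end

theory Submission
  imports Defs
begin

text \<open>
  Suppose that \<open>U\<close> is convex, and fix \<open>x \<in> X\<close> and \<open>y\<^sub>0 \<in> Y\<close>. Convex combinations of the utilities
  \<open>b(\<cdot>, y\<^sub>1) + C\<close> and \<open>b(\<cdot>, y\<^sub>2) + C\<close> are again \<open>b\<close>-convex, hence supported at \<open>x\<close> by some \<open>b(\<cdot>, y)\<close>;
  comparing gradients, the image \<open>K\<close> of \<open>cl Y\<close> under \<open>y \<mapsto> D\<^sub>xb(x, y)\<close> is convex. The fibre of this map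
  over \<open>D\<^sub>xb(x, y\<^sub>0)\<close> is connected, and \<open>y\<^sub>0\<close> is isolated in it by the rank condition, so points of
  \<open>K\<close> near \<open>D\<^sub>xb(x, y\<^sub>0)\<close> come from goods near \<open>y\<^sub>0\<close>; moving along the segments of \<open>K\<close>
  that start there shows that \<open>K - D\<^sub>xb(x, y\<^sub>0)\<close> lies in the range of \<open>D\<^sup>2\<^sub>x\<^sub>yb(x, y\<^sub>0)\<close>. By symmetry of
  second derivatives this range is the orthogonal complement of the kernel of \<open>DQ(x)\<close>, where
  \<open>Q = D\<^sub>yb(\<cdot>, y\<^sub>0)\<close>. Therefore, for every \<open>y\<close>, the derivative of \<open>b(\<cdot>, y) - b(\<cdot>, y\<^sub>0)\<close> vanishes
  along the fibres of the submersion \<open>Q\<close>, and the function is constant on them because they are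
  connected. So it factors through \<open>Q\<close>, and the remaining claims are changes of variables.
\<close>

section \<open>Symmetry of second derivatives\<close>

text \<open>The mean value theorem in direction \<open>u\<close> turns the second difference into an
  increment of \<open>G\<close> in direction \<open>v\<close>. Both values of \<open>G\<close> are
  compared with the same linear map \<open>G'\<close> at \<open>p\<close>, so the remainders are
  o(t) and differentiability of \<open>G\<close> at the single point \<open>p\<close>
  suffices.\<close>

lemma second_difference_tendsto:
  fixes f :: "'a::real_inner \<Rightarrow> real"
  assumes "open S" "p \<in> S"
    and grad: "\<And>q. q \<in> S \<Longrightarrow> GDERIV f q :> G q"
    and G': "(G has_derivative G') (at p)"
  shows "((\<lambda>t. (f (p + t *\<^sub>R u + t *\<^sub>R v) - f (p + t *\<^sub>R u) - f (p + t *\<^sub>R v) + f p) / t\<^sup>2)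
           \<longlongrightarrow> G' v \<bullet> u) (at_right 0)"
proof (rule tendstoI)
  fix e :: real
  assume "e > 0"
  define K where "K = norm u + norm v + 1"
  have K: "K > 0" "norm u < K"
    by (auto simp: K_def add_nonneg_pos intro: add_nonneg_pos)
  \<comment> \<open>Two remainders of norm at most \<open>e' * (t * K)\<close>, paired with a vector
    of norm below \<open>K\<close>, contribute at most \<open>t * (e / 2)\<close>.\<close>
  define e' where "e' = e / (4 * K * K)"
  have "e' > 0"
    using \<open>e > 0\<close> K by (simp add: e'_def)
  interpret G': bounded_linear G'
    using G' by (rule has_derivative_bounded_linear)
  obtain d where "d > 0"
    and d: "\<And>q. norm (q - p) < d \<Longrightarrow> norm (G q - G p - G' (q - p)) \<le> e' * norm (q - p)"
    using G' \<open>e' > 0\<close> unfolding has_derivative_at_alt by meson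
  obtain r where "r > 0" and r: "ball p r \<subseteq> S"
    using \<open>open S\<close> \<open>p \<in> S\<close> openE by blast
  have "dist ((f (p + t *\<^sub>R u + t *\<^sub>R v) - f (p + t *\<^sub>R u) - f (p + t *\<^sub>R v) + f p) / t\<^sup>2)
          (G' v \<bullet> u) < e"
    if t: "0 < t" "t < min d r / K" for t
  proof -
    have tK: "t * K < d" "t * K < r"
      using t K by (auto simp: field_simps)
    have small: "norm (s *\<^sub>R u + a *\<^sub>R v) \<le> t * K" if "0 \<le> s" "s \<le> t" "0 \<le> a" "a \<le> t" for s a
    proof -
      have "norm (s *\<^sub>R u + a *\<^sub>R v) \<le> s * norm u + a * norm v"
        using norm_triangle_ineq[of "s *\<^sub>R u" "a *\<^sub>R v"] that by simp
      also have "\<dots> \<le> t * norm u + t * norm v"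
        using that by (intro add_mono mult_right_mono) auto
      also have "\<dots> \<le> t * K"
        using t by (simp add: K_def algebra_simps)
      finally show ?thesis .
    qed
    have inS: "p + s *\<^sub>R u + a *\<^sub>R v \<in> S" if "0 \<le> s" "s \<le> t" "0 \<le> a" "a \<le> t" for s a
    proof -
      have "dist p (p + s *\<^sub>R u + a *\<^sub>R v) = norm (s *\<^sub>R u + a *\<^sub>R v)"
        by (metis add.assoc add_diff_cancel_left' dist_commute dist_norm)
      then show ?thesis
        using small[OF that] tK r by (simp add: subset_eq)
    qed
    \<comment> \<open>The second difference is \<open>\<psi> t - \<psi> 0\<close>. The summand
      \<open>0 *\<^sub>R v\<close> keeps both terms in the shape of \<open>f_line\<close>, with
      \<open>a = t\<close> and \<open>a = 0\<close>.\<close>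
    define \<psi> where "\<psi> s = f (p + s *\<^sub>R u + t *\<^sub>R v) - f (p + s *\<^sub>R u + 0 *\<^sub>R v)" for s
    have f_line: "((\<lambda>s. f (p + s *\<^sub>R u + a *\<^sub>R v)) has_derivative
        (\<lambda>k. (k *\<^sub>R u) \<bullet> G (p + s *\<^sub>R u + a *\<^sub>R v))) (at s)"
      if "0 \<le> s" "s \<le> t" "0 \<le> a" "a \<le> t" for s a
    proof -
      have "(f has_derivative (\<lambda>h. h \<bullet> G (p + s *\<^sub>R u + a *\<^sub>R v))) (at (p + s *\<^sub>R u + a *\<^sub>R v))"
        using grad[OF inS[OF that]] by (simp add: gderiv_def)
      moreover have "((\<lambda>s. p + s *\<^sub>R u + a *\<^sub>R v) has_derivative (\<lambda>k. k *\<^sub>R u)) (at s)"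
        by (auto intro!: derivative_eq_intros)
      ultimately show ?thesis
        by (rule has_derivative_compose[rotated])
    qed
    define \<psi>' where "\<psi>' s k = (k *\<^sub>R u) \<bullet> G (p + s *\<^sub>R u + t *\<^sub>R v) -
      (k *\<^sub>R u) \<bullet> G (p + s *\<^sub>R u + 0 *\<^sub>R v)" for s k
    have \<psi>: "(\<psi> has_derivative \<psi>' s) (at s)" if "0 \<le> s" "s \<le> t" for s
      unfolding \<psi>_def \<psi>'_def
      by (intro has_derivative_diff f_line) (use that t in auto)
    then obtain \<tau> where \<tau>: "0 < \<tau>" "\<tau> < t" "\<psi> t - \<psi> 0 = \<psi>' \<tau> (t - 0)"
      using mvt[of 0 t \<psi> \<psi>'] t
      by (metis atLeastAtMost_iff has_derivative_continuous_on has_derivative_at_withinI less_eq_real_def)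
    define R where "R a = G (p + \<tau> *\<^sub>R u + a *\<^sub>R v) - G p - G' (\<tau> *\<^sub>R u + a *\<^sub>R v)" for a
    have R: "norm (R a) \<le> e' * (t * K)" if "0 \<le> a" "a \<le> t" for a
    proof -
      have "norm (\<tau> *\<^sub>R u + a *\<^sub>R v) \<le> t * K"
        using small[of \<tau> a] \<tau> that by simp
      then show ?thesis
        using d[of "p + \<tau> *\<^sub>R u + a *\<^sub>R v"] tK \<open>e' > 0\<close>
        by (simp add: R_def add.assoc) (smt (verit) mult_left_mono)
    qed
    have "\<psi> t - \<psi> 0 = t * (t * (G' v \<bullet> u) + u \<bullet> (R t - R 0))"
      unfolding \<tau> \<psi>'_def R_def
      by (simp add: G'.add G'.scaleR algebra_simps inner_diff_right inner_add_right inner_commute)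
    moreover have "f (p + t *\<^sub>R u + t *\<^sub>R v) - f (p + t *\<^sub>R u) - f (p + t *\<^sub>R v) + f p = \<psi> t - \<psi> 0"
      by (simp add: \<psi>_def)
    ultimately have eq: "(f (p + t *\<^sub>R u + t *\<^sub>R v) - f (p + t *\<^sub>R u) - f (p + t *\<^sub>R v) + f p) / t\<^sup>2
        - G' v \<bullet> u = u \<bullet> (R t - R 0) / t"
      using t by (simp add: power2_eq_square field_simps)
    have "\<bar>u \<bullet> (R t - R 0)\<bar> \<le> norm u * norm (R t - R 0)"
      by (rule Cauchy_Schwarz_ineq2)
    also have "\<dots> \<le> K * (2 * (e' * (t * K)))"
      using R[of t] R[of 0] t K norm_triangle_ineq4[of "R t" "R 0"]
      by (intro mult_mono) auto
    also have "\<dots> = t * (e / 2)"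
      using K by (simp add: e'_def)
    also have "\<dots> < t * e"
      using \<open>e > 0\<close> t by simp
    finally show ?thesis
      unfolding dist_real_def eq using t by (simp add: field_simps)
  qed
  moreover have "0 < min d r / K"
    using \<open>d > 0\<close> \<open>r > 0\<close> K by simp
  ultimately show "\<forall>\<^sub>F t in at_right 0.
      dist ((f (p + t *\<^sub>R u + t *\<^sub>R v) - f (p + t *\<^sub>R u) - f (p + t *\<^sub>R v) + f p) / t\<^sup>2) (G' v \<bullet> u) < e"
    unfolding eventually_at_right_field by blast
qed

text \<open>Exchanging \<open>u\<close> and \<open>v\<close> leaves the second difference unchanged,
  so both inner products are its limit.\<close>

lemma second_derivative_symmetric:
  fixes f :: "'a::real_inner \<Rightarrow> real"
  assumes "open S" "p \<in> S"
    and "\<And>q. q \<in> S \<Longrightarrow> GDERIV f q :> G q"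
    and "(G has_derivative G') (at p)"
  shows "G' u \<bullet> v = G' v \<bullet> u"
proof (rule tendsto_unique[OF _ second_difference_tendsto[OF assms]])
  show "((\<lambda>t. (f (p + t *\<^sub>R v + t *\<^sub>R u) - f (p + t *\<^sub>R v) - f (p + t *\<^sub>R u) + f p) / t\<^sup>2)
           \<longlongrightarrow> G' v \<bullet> u) (at_right 0)"
  proof -
    have "f (p + t *\<^sub>R v + t *\<^sub>R u) - f (p + t *\<^sub>R v) - f (p + t *\<^sub>R u) =
        f (p + t *\<^sub>R u + t *\<^sub>R v) - f (p + t *\<^sub>R u) - f (p + t *\<^sub>R v)" for t
      by (subst add.commute[of "p + t *\<^sub>R v"]) (simp add: add.assoc add.left_commute)
    then show ?thesis
      using second_difference_tendsto[OF assms, of u v] by (simp only:)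
  qed
qed simp

section \<open>Tangent spaces of convex images\<close>

text \<open>The ball makes \<open>{y}\<close> relatively open and points are closed, so
  \<open>{y}\<close> is clopen in a connected set.\<close>

lemma connected_isolated_point:
  assumes "connected L" "y \<in> L" "d > 0" "\<And>z. z \<in> L \<Longrightarrow> dist z y < d \<Longrightarrow> z = y"
  shows "L = {y}"
proof -
  have "{y} = L \<inter> ball y d"
    using assms by (auto simp: dist_commute)
  then have "openin (top_of_set L) {y}"
    by (metis open_ball openin_open)
  moreover have "closedin (top_of_set L) {y}"
    using assms by (simp add: closed_subset)
  ultimately show ?thesis
    using \<open>connected L\<close> unfolding connected_clopen by blast
qed

text \<open>Injectivity of \<open>D\<close> shrinks the connected fibre to \<open>{y}\<close>, and
  compactness of \<open>K\<close> then forces preimages of points near \<open>\<phi> y\<close> to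
  lie near \<open>y\<close>. Preimages of points on the segment towards \<open>\<phi> z\<close>
  yield difference quotients whose images under \<open>D\<close> approach
  \<open>\<phi> z - \<phi> y\<close>, and \<open>range D\<close> is closed.\<close>

lemma convex_image_subset_tangent_space:
  fixes \<phi> :: "'a::euclidean_space \<Rightarrow> 'b::euclidean_space"
  assumes "compact K" and cont: "continuous_on K \<phi>" and "convex (\<phi> ` K)"
    and y: "y \<in> K" and D: "(\<phi> has_derivative D) (at y within K)" and "inj D"
    and fibre: "connected {w \<in> K. \<phi> w = \<phi> y}"
    and z: "z \<in> K"
  shows "\<phi> z - \<phi> y \<in> range D"
proof -
  interpret D: bounded_linear D
    using D by (rule has_derivative_bounded_linear)
  obtain B where "B > 0" and B: "\<And>h. B * norm h \<le> norm (D h)"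
    using linear_inj_bounded_below_pos[OF D.linear \<open>inj D\<close>] by blast
  have remainder: "\<exists>d>0. \<forall>w\<in>K. norm (w - y) < d \<longrightarrow>
      norm (\<phi> w - \<phi> y - D (w - y)) \<le> e * norm (w - y)" if "e > 0" for e
    using D that unfolding has_derivative_within_alt by blast
  \<comment> \<open>With error constant \<open>B / 2\<close> the linear part, bounded below by
    \<open>B\<close>, dominates, so no second point of the fibre lies within \<open>d\<close> of
    \<open>y\<close>.\<close>
  obtain d where "d > 0"
    and d: "\<And>w. w \<in> K \<Longrightarrow> norm (w - y) < d \<Longrightarrow> norm (\<phi> w - \<phi> y - D (w - y)) \<le> B / 2 * norm (w - y)"
    using remainder[of "B / 2"] \<open>B > 0\<close> by auto
  have "{w \<in> K. \<phi> w = \<phi> y} = {y}"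
  proof (rule connected_isolated_point[OF fibre _ \<open>d > 0\<close>])
    fix w
    assume w: "w \<in> {w \<in> K. \<phi> w = \<phi> y}" "dist w y < d"
    then have "B * norm (w - y) \<le> B / 2 * norm (w - y)"
      using d[of w] B[of "w - y"] by (simp add: dist_norm)
    then show "w = y"
      using \<open>B > 0\<close> by (simp add: field_simps)
  qed (use y in simp)
  then have fibre_single: "w = y" if "w \<in> K" "\<phi> w = \<phi> y" for w
    using that by blast
  define p where "p = \<phi> z - \<phi> y"
  have "p \<in> closure (range D)"
    unfolding closure_approachable
  proof safe
    fix e :: real
    assume "e > 0"
    \<comment> \<open>The first bound lets the remainder be absorbed into the lower bound for
      \<open>D\<close>, so that \<open>norm (w - y)\<close> is O(t); the second then pushes the
      remainder below \<open>t * e\<close>. The \<open>+ 1\<close> guards against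
      \<open>p = 0\<close>.\<close>
    define e' where "e' = min (B / 2) (e * B / (4 * (norm p + 1)))"
    have "e' > 0"
      using \<open>B > 0\<close> \<open>e > 0\<close> norm_ge_zero[of p] by (simp add: e'_def add_nonneg_pos)
    obtain d' where "d' > 0" and d': "\<And>w. w \<in> K \<Longrightarrow> norm (w - y) < d' \<Longrightarrow>
        norm (\<phi> w - \<phi> y - D (w - y)) \<le> e' * norm (w - y)"
      using remainder[OF \<open>e' > 0\<close>] by auto
    \<comment> \<open>The part of \<open>K\<close> away from \<open>y\<close> has a compact image
      that misses \<open>\<phi> y\<close>, so a whole ball around \<open>\<phi> y\<close> misses
      it.\<close>
    let ?far = "\<phi> ` (K - ball y d')"
    have "compact ?far"
      by (intro compact_continuous_image continuous_on_subset[OF cont] compact_diff \<open>compact K\<close>) auto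
    then have "open (- ?far)"
      using compact_imp_closed by blast
    moreover have "\<phi> y \<in> - ?far"
      using fibre_single \<open>d' > 0\<close> by force
    ultimately obtain r where "r > 0" and r: "ball (\<phi> y) r \<subseteq> - ?far"
      using openE by blast
    \<comment> \<open>Small enough to stay inside that ball, and at most 1 to stay on the segment
      from \<open>\<phi> y\<close> to \<open>\<phi> z\<close>.\<close>
    define t where "t = min 1 (r / (2 * (norm p + 1)))"
    have np: "norm p + 1 > 0"
      by (simp add: add_nonneg_pos)
    have t: "0 < t" "t \<le> 1" "t \<le> r / (2 * (norm p + 1))"
      using \<open>r > 0\<close> np by (auto simp: t_def)
    have "t * norm p < r"
    proof -
      have "t * norm p \<le> t * (norm p + 1)" using t by simp
      also have "\<dots> \<le> r / 2" using t(3) np by (simp add: field_simps)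
      finally show ?thesis using \<open>r > 0\<close> by simp
    qed
    have "\<phi> y + t *\<^sub>R p = (1 - t) *\<^sub>R \<phi> y + t *\<^sub>R \<phi> z"
      by (simp add: p_def algebra_simps)
    also have "\<dots> \<in> \<phi> ` K"
      using \<open>convex (\<phi> ` K)\<close> y z t by (intro convexD) auto
    finally obtain w where w: "w \<in> K" "\<phi> w = \<phi> y + t *\<^sub>R p"
      by force
    have "\<phi> w \<in> ball (\<phi> y) r"
      using w \<open>t * norm p < r\<close> t by (simp add: dist_norm)
    then have "w \<in> ball y d'"
      using r w by blast
    then have rem: "norm (t *\<^sub>R p - D (w - y)) \<le> e' * norm (w - y)"
      using d'[of w] w by (simp add: dist_norm norm_minus_commute)
    have "B * norm (w - y) \<le> norm (D (w - y))"
      by (rule B)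
    also have "\<dots> \<le> norm (t *\<^sub>R p) + norm (t *\<^sub>R p - D (w - y))"
      using norm_triangle_ineq4[of "t *\<^sub>R p" "t *\<^sub>R p - D (w - y)"] by simp
    also have "\<dots> \<le> t * norm p + B / 2 * norm (w - y)"
    proof -
      have "e' * norm (w - y) \<le> B / 2 * norm (w - y)"
        unfolding e'_def by (intro mult_right_mono min.cobounded1 norm_ge_zero)
      then show ?thesis
        using rem t by simp
    qed
    finally have wy: "norm (w - y) \<le> 2 / B * (t * norm p)"
      using \<open>B > 0\<close> by (simp add: field_simps)
    have "norm (t *\<^sub>R p - D (w - y)) \<le> e' * (2 / B * (t * norm p))"
      using rem mult_left_mono[OF wy, of e'] \<open>e' > 0\<close> by linarith
    also have "\<dots> \<le> e * B / (4 * (norm p + 1)) * (2 / B * (t * norm p))"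
      using \<open>B > 0\<close> t by (intro mult_right_mono) (auto simp: e'_def)
    also have "\<dots> = t * (e / 2) * (norm p / (norm p + 1))"
      using \<open>B > 0\<close> np by (simp add: field_simps)
    also have "\<dots> \<le> t * (e / 2)"
      using t \<open>e > 0\<close> np by (intro mult_left_le) (auto simp: field_simps)
    also have "\<dots> < t * e"
      using t \<open>e > 0\<close> by simp
    \<comment> \<open>Factoring out \<open>t\<close> exhibits the difference quotient of
      \<open>w\<close> as the vector whose image under \<open>D\<close> is within \<open>e\<close>
      of \<open>p\<close>.\<close>
    also have "t *\<^sub>R p - D (w - y) = t *\<^sub>R (p - D ((1 / t) *\<^sub>R (w - y)))"
      using t D.scaleR[of t "(1 / t) *\<^sub>R (w - y)"] by (simp add: scaleR_diff_right[of t p])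
    finally have "norm (t *\<^sub>R (p - D ((1 / t) *\<^sub>R (w - y)))) < t * e" .
    then have "dist (D ((1 / t) *\<^sub>R (w - y))) p < e"
      using t by (simp add: dist_norm norm_minus_commute)
    then show "\<exists>q\<in>range D. dist q p < e"
      by blast
  qed
  moreover have "closed (range D)"
    using D.linear by (intro closed_subspace linear_subspace_image) auto
  ultimately show ?thesis
    by (simp add: p_def)
qed

section \<open>Functions constant on the fibres of a submersion\<close>

text \<open>In suitable coordinates the fibre becomes a piece of an affine subspace parallel to the
  kernel of \<open>Q' a\<close>. Along a segment in it, the chain rule and \<open>kernel\<close>
  make the derivative of \<open>F\<close> vanish.\<close>

lemma submersion_fibre_locally_constant:
  fixes Q :: "'a::euclidean_space \<Rightarrow> 'b::euclidean_space" and Q' :: "'a \<Rightarrow> 'a \<Rightarrow>\<^sub>L 'b"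
    and F :: "'a \<Rightarrow> 'c::real_normed_vector"
  assumes "open X"
    and Q': "\<And>x. x \<in> X \<Longrightarrow> (Q has_derivative Q' x) (at x)"
    and "continuous_on X Q'"
    and F': "\<And>x. x \<in> X \<Longrightarrow> (F has_derivative F' x) (at x)"
    and kernel: "\<And>x h. x \<in> X \<Longrightarrow> Q' x h = 0 \<Longrightarrow> F' x h = 0"
    and "a \<in> X" "surj (Q' a)"
  obtains U where "open U" "a \<in> U" "\<And>x. x \<in> U \<Longrightarrow> Q x = Q a \<Longrightarrow> F x = F a"
proof -
  obtain A where "linear A" and A: "Q' a \<circ> A = id"
    using linear_surjective_right_inverse[of "Q' a"] \<open>surj (Q' a)\<close> blinfun.bounded_linear_right bounded_linear.linear by blast
  have A': "Q' a (A q) = q" for q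
    using A by (metis comp_apply id_apply)
  have blA: "bounded_linear A"
    using \<open>linear A\<close> by (simp add: linear_conv_bounded_linear)
  \<comment> \<open>A local diffeomorphism that straightens \<^term>\<open>Q\<close>: \<^prop>\<open>Q = Q' a \<circ> T\<close> with \<^term>\<open>Q' a\<close> linear.\<close>
  define T where "T x = x + A (Q x - Q' a x)" for x
  define T' where "T' x = id_blinfun + (Blinfun A o\<^sub>L (Q' x - Q' a))" for x
  have QT: "Q' a (T x) = Q x" for x
    by (simp add: T_def blinfun.add_right A')
  have T': "(T has_derivative T' x) (at x)" if "x \<in> X" for x
  proof -
    have "((\<lambda>x. x + A (Q x - Q' a x)) has_derivative (\<lambda>h. h + A (Q' x h - Q' a h))) (at x)"
      by (intro has_derivative_add has_derivative_ident bounded_linear.has_derivative[OF blA]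
          has_derivative_diff Q' that bounded_linear.has_derivative[OF blinfun.bounded_linear_right])
    then show ?thesis
      unfolding T_def[abs_def] by (rule has_derivative_eq_rhs)
        (auto simp: T'_def blinfun.add_left blinfun.diff_left bounded_linear_Blinfun_apply[OF blA])
  qed
  have contT': "continuous_on X T'"
    unfolding T'_def
    by (intro continuous_intros bounded_bilinear.continuous_on[OF bounded_bilinear_blinfun_compose]
        \<open>continuous_on X Q'\<close>)
  \<comment> \<open>At \<open>a\<close> the correction term vanishes, so \<open>T' a\<close> is the
    identity and is its own inverse in the inverse function theorem.\<close>
  have T'a: "id_blinfun o\<^sub>L T' a = id_blinfun"
    by (rule blinfun_eqI) (simp add: T'_def blinfun.add_left blinfun.zero_right bounded_linear_Blinfun_apply[OF blA]
        linear_0[OF \<open>linear A\<close>])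
  obtain U' V g g' where "open U'" "U' \<subseteq> X" "a \<in> U'" "open V" "T a \<in> V"
    and hom: "homeomorphism U' V T g"
    and g': "\<And>w. w \<in> V \<Longrightarrow> (g has_derivative g' w) (at w)"
    using inverse_function_theorem[OF \<open>open X\<close> T' contT' \<open>a \<in> X\<close> T'a] by metis
  obtain r where "r > 0" and r: "ball (T a) r \<subseteq> V"
    using \<open>open V\<close> \<open>T a \<in> V\<close> openE by blast
  \<comment> \<open>The ball is convex, so the segment from \<open>T a\<close> to \<open>T x\<close>
    stays in the domain \<open>V\<close> of the inverse \<open>g\<close>.\<close>
  define U where "U = U' \<inter> T -` ball (T a) r"
  show ?thesis
  proof
    show "open U"
      unfolding U_def using hom \<open>open U'\<close>
      by (intro continuous_open_preimage) (auto simp: homeomorphism_def)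
    show "a \<in> U"
      using \<open>a \<in> U'\<close> \<open>r > 0\<close> by (simp add: U_def)
    fix x
    assume "x \<in> U" and Qx: "Q x = Q a"
    then have x: "x \<in> U'" "T x \<in> ball (T a) r"
      by (auto simp: U_def)
    have gV: "g w \<in> X" "T (g w) = w" if "w \<in> V" for w
      using hom that \<open>U' \<subseteq> X\<close> by (auto simp: homeomorphism_def)
    have gT: "g (T x) = x" if "x \<in> U'" for x
      using hom that by (auto simp: homeomorphism_def)
    \<comment> \<open>Differentiating \<open>Q \<circ> g = Q' a\<close> on \<open>V\<close>:
      \<open>g' w\<close> carries the kernel of \<open>Q' a\<close> into that of
      \<open>Q' (g w)\<close>, where \<open>F'\<close> vanishes.\<close>
    have Qg: "Q' (g w) (g' w h) = Q' a h" if "w \<in> V" for w h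
    proof -
      have "((\<lambda>w. Q (g w)) has_derivative (\<lambda>h. Q' (g w) (g' w h))) (at w)"
        by (rule has_derivative_compose[OF g'[OF that] Q'[OF gV(1)[OF that]]])
      moreover have "((\<lambda>w. Q (g w)) has_derivative Q' a) (at w)"
      proof (rule has_derivative_transform_within_open[OF _ \<open>open V\<close> that])
        show "(Q' a has_derivative Q' a) (at w)"
          by (intro bounded_linear_imp_has_derivative blinfun.bounded_linear_right)
        show "Q' a w = Q (g w)" if "w \<in> V" for w
          using QT[of "g w"] gV[OF that] by simp
      qed
      ultimately show ?thesis
        by (metis has_derivative_unique)
    qed
    define \<gamma> where "\<gamma> s = T a + s *\<^sub>R (T x - T a)" for s :: real
    have \<gamma>V: "\<gamma> s \<in> V" if "s \<in> {0..1}" for s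
    proof -
      have "\<gamma> s = (1 - s) *\<^sub>R T a + s *\<^sub>R T x"
        by (simp add: \<gamma>_def algebra_simps)
      also have "\<dots> \<in> ball (T a) r"
        using that x \<open>r > 0\<close> by (intro convexD[OF convex_ball]) auto
      finally show ?thesis using r by blast
    qed
    have "Q' a (T x - T a) = 0"
      by (simp add: blinfun.diff_right QT Qx)
    have "\<exists>c. \<forall>s\<in>{0..1}. F (g (\<gamma> s)) = c"
    proof (rule has_derivative_zero_constant)
      fix s :: real
      assume s: "s \<in> {0..1}"
      have "(\<gamma> has_derivative (\<lambda>k. k *\<^sub>R (T x - T a))) (at s)"
        unfolding \<gamma>_def by (auto intro!: derivative_eq_intros)
      then have "((\<lambda>s. F (g (\<gamma> s))) has_derivative
          (\<lambda>k. F' (g (\<gamma> s)) (g' (\<gamma> s) (k *\<^sub>R (T x - T a))))) (at s)"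
        by (intro has_derivative_compose[OF _ F'] has_derivative_compose[OF _ g'] gV \<gamma>V s)
      moreover have "F' (g (\<gamma> s)) (g' (\<gamma> s) (k *\<^sub>R (T x - T a))) = 0" for k
        using kernel[OF gV(1)[OF \<gamma>V[OF s]]] Qg[OF \<gamma>V[OF s]] \<open>Q' a (T x - T a) = 0\<close>
        by (simp add: blinfun.scaleR_right)
      ultimately show "((\<lambda>s. F (g (\<gamma> s))) has_derivative (\<lambda>h. 0)) (at s within {0..1})"
        by (simp add: has_derivative_at_withinI)
    qed simp
    then have "F (g (\<gamma> 1)) = F (g (\<gamma> 0))"
      by (metis atLeastAtMost_iff order_refl zero_le_one)
    then show "F x = F a"
      by (simp add: \<gamma>_def gT x \<open>a \<in> U'\<close>)
  qed
qed

text \<open>Connectedness of the fibre turns local constancy into constancy.\<close>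

lemma submersion_fibre_constant:
  fixes Q :: "'a::euclidean_space \<Rightarrow> 'b::euclidean_space" and Q' :: "'a \<Rightarrow> 'a \<Rightarrow>\<^sub>L 'b"
    and F :: "'a \<Rightarrow> 'c::real_normed_vector"
  assumes "open X"
    and "\<And>x. x \<in> X \<Longrightarrow> (Q has_derivative Q' x) (at x)"
    and "continuous_on X Q'"
    and "\<And>x. x \<in> X \<Longrightarrow> (F has_derivative F' x) (at x)"
    and "\<And>x h. x \<in> X \<Longrightarrow> Q' x h = 0 \<Longrightarrow> F' x h = 0"
    and surj: "\<And>x. x \<in> X \<Longrightarrow> surj (Q' x)"
    and "connected {x \<in> X. Q x = q}" "x \<in> X" "x' \<in> X" "Q x = q" "Q x' = q"
  shows "F x = F x'"
proof (rule connected_local_const[OF \<open>connected {x \<in> X. Q x = q}\<close>])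
  show "\<forall>a\<in>{x \<in> X. Q x = q}. \<forall>\<^sub>F x in at a within {x \<in> X. Q x = q}. F a = F x"
  proof
    fix a
    assume a: "a \<in> {x \<in> X. Q x = q}"
    then obtain U where "open U" "a \<in> U" "\<And>x. x \<in> U \<Longrightarrow> Q x = Q a \<Longrightarrow> F x = F a"
      using submersion_fibre_locally_constant[OF assms(1-5), of a] surj by blast
    then show "\<forall>\<^sub>F x in at a within {x \<in> X. Q x = q}. F a = F x"
      using a unfolding eventually_at_topological by (metis (mono_tags, lifting) mem_Collect_eq)
  qed
qed (use assms in auto)

section \<open>Derivatives up to the boundary\<close>

lemma grad_eqI: "GDERIV f x :> d \<Longrightarrow> grad f x = d"
  unfolding grad_def
proof (rule the_equality)
  fix d'
  assume "GDERIV f x :> d" "GDERIV f x :> d'"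
  then have "(\<lambda>h. h \<bullet> d') = (\<lambda>h. h \<bullet> d)"
    unfolding gderiv_def by (rule has_derivative_unique[rotated])
  then show "d' = d"
    by (metis vector_eq_ldot)
qed

lemma Ck_on_closure_imp_continuous_on: "Ck_on_closure k S f \<Longrightarrow> continuous_on (closure S) f"
  by (cases k) auto

lemma Ck_on_closure_gradientE:
  assumes "Ck_on_closure (Suc k) S f"
  obtains g where "\<And>p. p \<in> S \<Longrightarrow> GDERIV f p :> g p" "continuous_on (closure S) g"
    "\<And>i. i \<in> Basis \<Longrightarrow> Ck_on_closure k S (\<lambda>p. g p \<bullet> i)"
proof -
  obtain g where g: "\<forall>p\<in>S. GDERIV f p :> g p" "\<forall>i\<in>Basis. Ck_on_closure k S (\<lambda>p. g p \<bullet> i)"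
    using assms by auto
  then have "continuous_on (closure S) g"
    using Ck_on_closure_imp_continuous_on by (subst continuous_on_componentwise) blast
  with g that show ?thesis
    by blast
qed

text \<open>The gradients of the components of \<open>g\<close> are the rows of its derivative.
  Packing them into a bounded linear map gives the form that the inverse function theorem expects;
  in finite dimension its continuity can be tested vector by vector.\<close>

lemma Ck_on_closure_second_derivativeE:
  assumes "Ck_on_closure (Suc (Suc k)) S f"
  obtains g g' where "\<And>p. p \<in> S \<Longrightarrow> GDERIV f p :> g p" "continuous_on (closure S) g"
    "\<And>p. p \<in> S \<Longrightarrow> (g has_derivative blinfun_apply (g' p)) (at p)" "continuous_on S g'"
proof -
  obtain g where g: "\<And>p. p \<in> S \<Longrightarrow> GDERIV f p :> g p" "continuous_on (closure S) g"
    and comp: "\<And>i. i \<in> Basis \<Longrightarrow> Ck_on_closure (Suc k) S (\<lambda>p. g p \<bullet> i)"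
    using Ck_on_closure_gradientE[OF assms] by blast
  have "\<forall>i\<in>Basis. \<exists>H. (\<forall>p\<in>S. GDERIV (\<lambda>p. g p \<bullet> i) p :> H p) \<and> continuous_on (closure S) H"
    using Ck_on_closure_gradientE[OF comp] by metis
  then obtain H where H: "\<And>i p. i \<in> Basis \<Longrightarrow> p \<in> S \<Longrightarrow> GDERIV (\<lambda>p. g p \<bullet> i) p :> H i p"
    and contH: "\<And>i. i \<in> Basis \<Longrightarrow> continuous_on (closure S) (H i)"
    by metis
  define g' where "g' p = Blinfun (\<lambda>h. \<Sum>i\<in>Basis. (h \<bullet> H i p) *\<^sub>R i)" for p
  have g'_apply: "blinfun_apply (g' p) h = (\<Sum>i\<in>Basis. (h \<bullet> H i p) *\<^sub>R i)" for p h
    unfolding g'_def by (subst bounded_linear_Blinfun_apply) (auto intro!: bounded_linear_intros)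
  show ?thesis
  proof (rule that[OF g])
    fix p
    assume "p \<in> S"
    then show "(g has_derivative g' p) (at p)"
      using H by (subst has_derivative_componentwise_within)
        (simp add: g'_apply inner_sum_left_Basis gderiv_def)
  next
    show "continuous_on S g'"
    proof (rule continuous_on_blinfun_componentwise)
      fix h :: 'a
      show "continuous_on S (\<lambda>p. g' p h)"
        unfolding g'_apply using contH closure_subset
        by (auto intro!: continuous_intros intro: continuous_on_subset)
    qed
  qed
qed

lemma GDERIV_partial:
  assumes "GDERIV (\<lambda>(x, y). b x y) (x, y) :> d"
  shows "GDERIV (\<lambda>x'. b x' y) x :> fst d" "GDERIV (\<lambda>y'. b x y') y :> snd d"
proof -
  have d: "((\<lambda>(x, y). b x y) has_derivative (\<lambda>h. h \<bullet> d)) (at (x, y))"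
    using assms by (simp add: gderiv_def)
  have "((\<lambda>x'. (x', y)) has_derivative (\<lambda>h. (h, 0))) (at x)"
    by (auto intro!: derivative_eq_intros)
  from has_derivative_compose[OF this d] show "GDERIV (\<lambda>x'. b x' y) x :> fst d"
    by (simp add: gderiv_def inner_prod_def)
  have "((\<lambda>y'. (x, y')) has_derivative (\<lambda>h. (0, h))) (at y)"
    by (auto intro!: derivative_eq_intros)
  from has_derivative_compose[OF this d] show "GDERIV (\<lambda>y'. b x y') y :> snd d"
    by (simp add: gderiv_def inner_prod_def)
qed

text \<open>A point of the closure outside \<open>S\<close> is a limit point of \<open>S\<close>, so
  the limit there is unique and equals the value of the continuous \<open>g\<close>. This replaces
  the limits in \<open>D_x\<close> and \<open>D_y\<close> by one continuous gradient field.\<close>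

lemma boundary_ext_eq:
  assumes cont: "continuous_on (closure S) g" and p: "p \<in> closure S"
    and eq: "\<And>q. q \<in> S \<Longrightarrow> f q = g q"
  shows "boundary_ext S f p = g p"
proof (cases "p \<in> S")
  case False
  then have nontriv: "at p within S \<noteq> bot"
    using p by (auto simp: at_within_eq_bot_iff)
  have "(g \<longlongrightarrow> g p) (at p within S)"
    using cont p closure_subset by (meson continuous_on_def tendsto_within_subset)
  then have "(f \<longlongrightarrow> g p) (at p within S)"
    by (rule Lim_transform_eventually) (simp add: eq eventually_at_filter)
  then show ?thesis
    using False nontriv by (simp add: boundary_ext_def tendsto_Lim)
qed (simp add: boundary_ext_def eq)

text \<open>A boundary good is a limit of goods in \<open>Y\<close>, and uniform convergence of the
  gradients allows differentiation of the limit. Boundary goods matter because a supporting good may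
  well lie there.\<close>

lemma GDERIV_boundary_parameter:
  fixes b :: "'a::euclidean_space \<Rightarrow> 'b::metric_space \<Rightarrow> real"
  assumes "open X" and x: "x \<in> X" and y: "y \<in> closure Y"
    and "compact (closure X \<times> closure Y)"
    and contb: "continuous_on (closure X \<times> closure Y) (\<lambda>(x, y). b x y)"
    and contg: "continuous_on (closure X \<times> closure Y) g"
    and grad: "\<And>x y. x \<in> X \<Longrightarrow> y \<in> Y \<Longrightarrow> GDERIV (\<lambda>x'. b x' y) x :> g (x, y)"
  shows "GDERIV (\<lambda>x'. b x' y) x :> g (x, y)"
proof -
  obtain r where "r > 0" and r: "ball x r \<subseteq> X"
    using \<open>open X\<close> x openE by blast
  obtain ys where ys: "\<And>n::nat. ys n \<in> Y" "ys \<longlonglongrightarrow> y"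
    using y by (auto simp: closure_sequential)
  have lim: "(\<lambda>n. b z (ys n)) \<longlonglongrightarrow> b z y" if "z \<in> ball x r" for z
  proof -
    have zX: "z \<in> closure X"
      using that r closure_subset by blast
    have "(\<lambda>n. (z, ys n)) \<longlonglongrightarrow> (z, y)"
      by (intro tendsto_intros ys)
    then have "(\<lambda>n. (\<lambda>(x, y). b x y) (z, ys n)) \<longlonglongrightarrow> (\<lambda>(x, y). b x y) (z, y)"
      using zX ys(1) y closure_subset[of Y]
      by (intro continuous_on_tendsto_compose[OF contb] always_eventually) auto
    then show ?thesis by simp
  qed
  have "\<exists>l. \<forall>z\<in>ball x r. (\<lambda>n. b z (ys n)) \<longlonglongrightarrow> l z \<and>
      (l has_derivative (\<lambda>h. h \<bullet> g (z, y))) (at z within ball x r)"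
  proof (rule has_derivative_sequence[OF convex_ball])
    show "((\<lambda>z. b z (ys n)) has_derivative (\<lambda>h. h \<bullet> g (z, ys n))) (at z within ball x r)"
      if "z \<in> ball x r" for n z
    proof -
      have "z \<in> X" using that r by blast
      then show ?thesis
        using grad[OF _ ys(1)] unfolding gderiv_def by (blast intro: has_derivative_at_withinI)
    qed
    show "x \<in> ball x r" "(\<lambda>n. b x (ys n)) \<longlonglongrightarrow> b x y"
      using \<open>r > 0\<close> lim by auto
    fix e :: real
    assume "e > 0"
    \<comment> \<open>Compactness makes closeness of \<open>ys n\<close> to \<open>y\<close> control
      the gradients uniformly in \<open>z\<close>, as the theorem on differentiating sequences
      demands.\<close>
    have "uniformly_continuous_on (closure X \<times> closure Y) g"
      using contg \<open>compact (closure X \<times> closure Y)\<close> by (rule compact_uniformly_continuous)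
    then obtain d where "d > 0" and d: "\<And>p q. p \<in> closure X \<times> closure Y \<Longrightarrow>
        q \<in> closure X \<times> closure Y \<Longrightarrow> dist q p < d \<Longrightarrow> dist (g q) (g p) < e"
      using \<open>e > 0\<close> unfolding uniformly_continuous_on_def by metis
    have "\<forall>\<^sub>F n in sequentially. dist (ys n) y < d"
      using ys(2) \<open>d > 0\<close> by (rule tendstoD)
    then show "\<forall>\<^sub>F n in sequentially. \<forall>z\<in>ball x r. \<forall>h.
        norm (h \<bullet> g (z, ys n) - h \<bullet> g (z, y)) \<le> e * norm h"
    proof eventually_elim
      case (elim n)
      show ?case
      proof (intro ballI allI)
        fix z h :: 'a
        assume "z \<in> ball x r"
        then have "z \<in> closure X" "ys n \<in> closure Y"
          using r ys(1)[of n] closure_subset[of X] closure_subset[of Y] by (auto simp: subset_eq)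
        then have "dist (g (z, ys n)) (g (z, y)) < e"
          using elim y by (intro d) (auto simp: dist_Pair_Pair)
        then have "norm (g (z, ys n) - g (z, y)) \<le> e"
          by (simp add: dist_norm)
        then have "norm h * norm (g (z, ys n) - g (z, y)) \<le> norm h * e"
          by (intro mult_left_mono) auto
        then show "norm (h \<bullet> g (z, ys n) - h \<bullet> g (z, y)) \<le> e * norm h"
          using Cauchy_Schwarz_ineq2[of h "g (z, ys n) - g (z, y)"]
          by (simp add: inner_diff_right mult.commute)
      qed
    qed
  qed
  then obtain l where l: "\<And>z. z \<in> ball x r \<Longrightarrow> (\<lambda>n. b z (ys n)) \<longlonglongrightarrow> l z"
    and l': "(l has_derivative (\<lambda>h. h \<bullet> g (x, y))) (at x within ball x r)"
    using centre_in_ball[of x r] \<open>r > 0\<close> by blast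
  \<comment> \<open>The sequence theorem yields some limit function \<open>l\<close>; uniqueness of
    limits identifies it.\<close>
  have "l z = b z y" if "z \<in> ball x r" for z
    using l[OF that] lim[OF that] LIMSEQ_unique by blast
  then have "((\<lambda>z. b z y) has_derivative (\<lambda>h. h \<bullet> g (x, y))) (at x within ball x r)"
    using \<open>r > 0\<close> by (intro has_derivative_transform[OF _ _ l']) auto
  then show ?thesis
    using \<open>r > 0\<close> by (simp add: gderiv_def at_within_open[of x "ball x r"])
qed

section \<open>Supporting goods and convexity of gradient images\<close>

text \<open>The schedule that offers only \<open>y\<close>, at price \<open>- C\<close>, and prices
  every other good at \<open>\<infinity>\<close> realises this utility.\<close>

lemma b_convex_single_good:
  assumes y: "y \<in> closure Y"
  shows "b_convex X Y b (\<lambda>x. b x y + C)"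
  unfolding b_convex_def
proof (intro exI conjI ballI)
  define v where "v y' = (if y' = y then ereal (- C) else \<infinity>)" for y'
  show "price_schedule Y v"
    by (simp add: price_schedule_def v_def)
  fix x
  show "ereal (b x y + C) = indirect_utility Y b v x"
    unfolding indirect_utility_def
  proof (rule antisym)
    show "ereal (b x y + C) \<le> (SUP y\<in>closure Y. ereal (b x y) - v y)"
      by (rule SUP_upper2[OF y]) (simp add: v_def)
    show "(SUP y\<in>closure Y. ereal (b x y) - v y) \<le> ereal (b x y + C)"
      by (rule SUP_least) (simp add: v_def)
  qed
qed

text \<open>As \<open>v\<close> carries no semicontinuity, the supremum at \<open>x0\<close> may not
  be attained. Near-maximizers subconverge by compactness, and since the price cancels from their
  inequalities, continuity of \<open>b\<close> alone carries these to the limit.\<close>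

lemma b_convex_supporting_good:
  assumes u: "b_convex X Y b u" and x0: "x0 \<in> X" and "bounded Y"
    and cont: "\<And>x. x \<in> X \<Longrightarrow> continuous_on (closure Y) (b x)"
  obtains y where "y \<in> closure Y" "\<And>x. x \<in> X \<Longrightarrow> b x y - b x0 y \<le> u x - u x0"
proof -
  obtain v where v: "price_schedule Y v"
    and uv: "\<And>x. x \<in> X \<Longrightarrow> ereal (u x) = (SUP y\<in>closure Y. ereal (b x y) - v y)"
    using u by (auto simp: b_convex_def indirect_utility_def)
  have "\<exists>y\<in>closure Y. ereal (u x0 - 1 / Suc n) < ereal (b x0 y) - v y" for n
  proof -
    have "ereal (u x0 - 1 / Suc n) < (SUP y\<in>closure Y. ereal (b x0 y) - v y)"
      using uv[OF x0, symmetric] by simp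
    then show ?thesis
      by (simp add: less_SUP_iff)
  qed
  then obtain ys where ys: "\<And>n. ys n \<in> closure Y"
    and ys_le: "\<And>n. ereal (u x0 - 1 / Suc n) < ereal (b x0 (ys n)) - v (ys n)"
    by metis
  have ys_bound: "b x (ys n) - b x0 (ys n) \<le> u x - u x0 + 1 / Suc n" if "x \<in> X" for x n
  proof -
    \<comment> \<open>The price is finite: \<open>price_schedule\<close> excludes
      \<open>-\<infinity>\<close>, and at \<open>\<infinity>\<close> the value would be
      \<open>-\<infinity>\<close>, contradicting \<open>ys_le\<close>. So it is a real
      \<open>a\<close> that cancels between the two inequalities below.\<close>
    have "v (ys n) \<noteq> -\<infinity>" "v (ys n) \<noteq> \<infinity>"
      using v ys[of n] ys_le[of n] by (auto simp: price_schedule_def)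
    then obtain a where a: "v (ys n) = ereal a"
      by (cases "v (ys n)") auto
    have "ereal (b x (ys n)) - v (ys n) \<le> ereal (u x)"
      unfolding uv[OF that] using ys by (rule SUP_upper)
    then have "b x (ys n) - a \<le> u x"
      by (simp add: a)
    moreover have "u x0 - 1 / Suc n < b x0 (ys n) - a"
      using ys_le[of n] by (simp add: a)
    ultimately show ?thesis by linarith
  qed
  have "compact (closure Y)"
    using \<open>bounded Y\<close> by simp
  then obtain y \<rho> where y: "y \<in> closure Y" and "strict_mono \<rho>" and lim: "(ys \<circ> \<rho>) \<longlonglongrightarrow> y"
    using ys unfolding compact_def by metis
  show ?thesis
  proof (rule that[OF y])
    fix x
    assume x: "x \<in> X"
    have blim: "(\<lambda>n. b z (ys (\<rho> n))) \<longlonglongrightarrow> b z y" if "z \<in> X" for z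
      using continuous_on_tendsto_compose[OF cont[OF that] lim y] ys by (simp add: o_def)
    have "(\<lambda>n. 1 / real (Suc n)) \<longlonglongrightarrow> 0"
      by (rule LIMSEQ_Suc[OF lim_1_over_n])
    then have "(\<lambda>n. u x - u x0 + 1 / real (Suc (\<rho> n))) \<longlonglongrightarrow> u x - u x0 + 0"
      by (intro tendsto_intros LIMSEQ_subseq_LIMSEQ[OF _ \<open>strict_mono \<rho>\<close>, unfolded o_def])
    moreover have "(\<lambda>n. b x (ys (\<rho> n)) - b x0 (ys (\<rho> n))) \<longlonglongrightarrow> b x y - b x0 y"
      by (intro tendsto_diff blim x x0)
    ultimately show "b x y - b x0 y \<le> u x - u x0"
      using ys_bound[OF x] by (intro LIMSEQ_le) auto
  qed
qed

text \<open>The good that supports a convex combination of two single-good utilities at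
  \<open>x0\<close> has the convex combination of their gradients as its own.\<close>

lemma convex_gradient_image:
  fixes X :: "'a::euclidean_space set" and Y :: "(real^'n) set"
  assumes conv: "convex_functions (U_b_phi X Y b c y\<phi>)"
    and "open X" "bounded X" "bounded Y" and y\<phi>: "y\<phi> \<in> closure Y"
    and cont: "continuous_on (closure X \<times> closure Y) (\<lambda>(x, y). b x y)"
    and grad: "\<And>y. y \<in> closure Y \<Longrightarrow> GDERIV (\<lambda>x. b x y) x0 :> g y"
    and x0: "x0 \<in> X"
  shows "convex (g ` closure Y)"
proof -
  have "compact (closure X \<times> closure Y)"
    using \<open>bounded X\<close> \<open>bounded Y\<close> by (simp add: compact_Times)
  then have "bounded ((\<lambda>(x, y). b x y) ` (closure X \<times> closure Y))"
    using cont by (intro compact_imp_bounded compact_continuous_image)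
  then obtain M where "\<And>p. p \<in> closure X \<times> closure Y \<Longrightarrow> norm ((\<lambda>(x, y). b x y) p) \<le> M"
    by (auto simp: bounded_iff)
  then have M: "\<bar>b x y\<bar> \<le> M" if "x \<in> X" "y \<in> closure Y" for x y
    using that closure_subset[of X] by fastforce
  have contb: "continuous_on (closure Y) (b x)" if "x \<in> X" for x
  proof -
    have "continuous_on (closure Y) (\<lambda>y. (\<lambda>(x, y). b x y) (x, y))"
      using that closure_subset
      by (intro continuous_on_compose2[OF cont] continuous_intros) auto
    then show ?thesis by simp
  qed
  \<comment> \<open>As \<open>b\<close> lies between \<open>- M\<close> and \<open>M\<close>, this
    gives \<open>b x y + C \<ge> M - c y\<phi> \<ge> b x y\<phi> - c y\<phi>\<close>: the
    participation constraint holds for every good, while gradients are unaffected.\<close>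
  define C where "C = 2 * M - c y\<phi>"
  have single: "(\<lambda>x. b x y + C) \<in> U_b_phi X Y b c y\<phi>" if "y \<in> closure Y" for y
    unfolding U_b_phi_def
  proof (intro CollectI conjI ballI b_convex_single_good that)
    fix x assume "x \<in> X"
    then show "b x y\<phi> - c y\<phi> \<le> b x y + C"
      using M[of x y] M[of x y\<phi>] that y\<phi> by (simp add: C_def abs_le_iff)
  qed
  show ?thesis
  proof (rule convexI, safe)
    fix y1 y2 and s t :: real
    assume y: "y1 \<in> closure Y" "y2 \<in> closure Y" and st: "0 \<le> s" "0 \<le> t" "s + t = 1"
    define w where "w x = s * (b x y1 + C) + t * (b x y2 + C)" for x
    have "w \<in> U_b_phi X Y b c y\<phi>"
      unfolding w_def using conv[unfolded convex_functions_def, rule_format,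
          OF single[OF y(1)] single[OF y(2)] st] .
    then have "b_convex X Y b w"
      by (simp add: U_b_phi_def)
    from b_convex_supporting_good[OF this x0 \<open>bounded Y\<close> contb]
    obtain y where y': "y \<in> closure Y" "\<And>x. x \<in> X \<Longrightarrow> b x y - b x0 y \<le> w x - w x0"
      by blast
    have "((\<lambda>x. w x - b x y) has_derivative
        (\<lambda>h. s * (h \<bullet> g y1) + t * (h \<bullet> g y2) - h \<bullet> g y)) (at x0)"
      unfolding w_def
      by (rule derivative_eq_intros grad[unfolded gderiv_def] y y' refl)+ (simp add: fun_eq_iff)
    \<comment> \<open>The interior point \<open>x0\<close> minimizes \<open>w - b(., y)\<close>, so
      the derivative there is zero.\<close>
    moreover have "\<forall>x\<in>X. w x0 - b x0 y \<le> w x - b x y"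
      using y' by (simp add: algebra_simps)
    ultimately have "(\<lambda>h. s * (h \<bullet> g y1) + t * (h \<bullet> g y2) - h \<bullet> g y) = (\<lambda>h. 0)"
      using differential_zero_maxmin[OF x0 \<open>open X\<close>] by blast
    then have "h \<bullet> (s *\<^sub>R g y1 + t *\<^sub>R g y2) = h \<bullet> g y" for h
      by (simp add: inner_add_right fun_eq_iff)
    then have "s *\<^sub>R g y1 + t *\<^sub>R g y2 = g y"
      by (metis vector_eq_ldot)
    then show "s *\<^sub>R g y1 + t *\<^sub>R g y2 \<in> g ` closure Y"
      using y' by simp
  qed
qed

section \<open>Preference differences on the fibres of \<open>Q\<close>\<close>

text \<open>Puts (B0) into working form: one joint gradient field \<open>G\<close>, continuous up to
  the boundary, whose components are the first derivatives of \<open>b\<close> and whose derivative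
  contains the mixed matrix as a block.\<close>

lemma B0_gradientE:
  fixes X :: "(real^'m) set" and Y :: "(real^'n) set"
  assumes "B0 X Y b" "open Y"
  obtains G G' where
    "\<And>p. p \<in> X \<times> Y \<Longrightarrow> GDERIV (\<lambda>(x, y). b x y) p :> G p"
    "continuous_on (closure X \<times> closure Y) (\<lambda>(x, y). b x y)"
    "continuous_on (closure X \<times> closure Y) G"
    "\<And>p. p \<in> X \<times> Y \<Longrightarrow> (G has_derivative blinfun_apply (G' p)) (at p)"
    "continuous_on (X \<times> Y) G'"
    "\<And>x y. x \<in> closure X \<Longrightarrow> y \<in> closure Y \<Longrightarrow> D_x X Y b x y = fst (G (x, y))"
    "\<And>x y. x \<in> closure X \<Longrightarrow> y \<in> closure Y \<Longrightarrow> D_y X Y b x y = snd (G (x, y))"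
    "\<And>x y. x \<in> X \<Longrightarrow> y \<in> Y \<Longrightarrow> D2_xy X Y b x y = matrix (\<lambda>k. fst (G' (x, y) (0, k)))"
proof -
  have "(4::nat) = Suc (Suc 2)"
    by simp
  then have Ck: "Ck_on_closure (Suc (Suc 2)) (X \<times> Y) (\<lambda>(x, y). b x y)"
    using \<open>B0 X Y b\<close> by (simp only: B0_def)
  from Ck_on_closure_second_derivativeE[OF this] obtain G G' where
    G: "\<And>p. p \<in> X \<times> Y \<Longrightarrow> GDERIV (\<lambda>(x, y). b x y) p :> G p"
    and contG: "continuous_on (closure (X \<times> Y)) G"
    and G': "\<And>p. p \<in> X \<times> Y \<Longrightarrow> (G has_derivative blinfun_apply (G' p)) (at p)"
    and contG': "continuous_on (X \<times> Y) G'"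
    by blast
  have grads: "grad (\<lambda>x'. b x' y) x = fst (G (x, y))" "grad (\<lambda>y'. b x y') y = snd (G (x, y))"
    if "x \<in> X" "y \<in> Y" for x y
    using GDERIV_partial[OF G[of "(x, y)"]] that by (auto intro: grad_eqI)
  show ?thesis
  proof (rule that[OF G _ _ G' contG'])
    show "continuous_on (closure X \<times> closure Y) (\<lambda>(x, y). b x y)"
      using Ck_on_closure_imp_continuous_on[OF Ck] by (simp add: closure_Times)
    show "continuous_on (closure X \<times> closure Y) G"
      using contG by (simp add: closure_Times)
  next
    fix x y
    assume xy: "x \<in> closure X" "y \<in> closure Y"
    then have "boundary_ext (X \<times> Y) (\<lambda>(x, y). grad (\<lambda>x'. b x' y) x) (x, y) = (fst \<circ> G) (x, y)"
      by (intro boundary_ext_eq continuous_intros continuous_on_compose contG)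
        (auto simp: closure_Times grads)
    then show "D_x X Y b x y = fst (G (x, y))"
      by (simp add: D_x_def)
    have "boundary_ext (X \<times> Y) (\<lambda>(x, y). grad (\<lambda>y'. b x y') y) (x, y) = (snd \<circ> G) (x, y)"
      using xy by (intro boundary_ext_eq continuous_intros continuous_on_compose contG)
        (auto simp: closure_Times grads)
    then show "D_y X Y b x y = snd (G (x, y))"
      by (simp add: D_y_def)
  next
    fix x y
    assume xy: "x \<in> X" "y \<in> Y"
    have "((\<lambda>y'. (x, y')) has_derivative (\<lambda>k. (0, k))) (at y)"
      by (auto intro!: derivative_eq_intros)
    from has_derivative_compose[OF this G'] xy
    have "((\<lambda>y'. fst (G (x, y'))) has_derivative (\<lambda>k. fst (G' (x, y) (0, k)))) (at y)"
      by (auto intro: has_derivative_fst)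
    then have "((\<lambda>y'. grad (\<lambda>x'. b x' y') x) has_derivative (\<lambda>k. fst (G' (x, y) (0, k)))) (at y)"
      using xy by (elim has_derivative_transform_within_open[OF _ \<open>open Y\<close>]) (auto simp: grads)
    then show "D2_xy X Y b x y = matrix (\<lambda>k. fst (G' (x, y) (0, k)))"
      using xy by (simp add: D2_xy_def boundary_ext_def jacobian_def frechet_derivative_at[symmetric])
  qed auto
qed

text \<open>Serves the measurability of \<open>Q\<close>.\<close>

lemma continuous_on_D_y:
  fixes X :: "(real^'m) set" and Y :: "(real^'n) set"
  assumes "B0 X Y b" "open Y" "y \<in> closure Y"
  shows "continuous_on X (\<lambda>x. D_y X Y b x y)"
proof -
  obtain G :: "(real^'m) \<times> (real^'n) \<Rightarrow> (real^'m) \<times> (real^'n)"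
    where contG: "continuous_on (closure X \<times> closure Y) G"
    and D_y: "\<And>x y. x \<in> closure X \<Longrightarrow> y \<in> closure Y \<Longrightarrow> D_y X Y b x y = snd (G (x, y))"
    by (rule B0_gradientE[OF assms(1,2)]) (rule that; assumption)
  have "continuous_on X (\<lambda>x. snd (G (x, y)))"
    using \<open>y \<in> closure Y\<close> closure_subset[of X]
    by (intro continuous_on_snd continuous_on_compose2[OF contG] continuous_on_Pair) auto
  then show ?thesis
    by (rule continuous_on_eq) (use assms closure_subset[of X] D_y in auto)
qed

text \<open>The gradient in \<open>x\<close> of the difference lies in the range of the mixed second
  derivative, which is orthogonal to the kernel of the derivative of \<open>Q\<close>. The dimension
  hypothesis makes full rank mean that the former map is injective, hence that \<open>Q\<close> is a
  submersion.\<close>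

lemma preference_difference_constant_on_fibre:
  fixes X :: "(real^'m) set" and Y :: "(real^'n) set"
  assumes "CARD('n) \<le> CARD('m)"
    and "open X" "bounded X" "open Y" "bounded Y"
    and "B0 X Y b" and B1: "B1 X Y b" and "y\<phi> \<in> closure Y"
    and conv: "convex_functions (U_b_phi X Y b c y\<phi>)"
    and y0: "y0 \<in> Y" and y: "y \<in> closure Y"
    and x: "x \<in> X" "x' \<in> X" "D_y X Y b x y0 = D_y X Y b x' y0"
  shows "b x y - b x y0 = b x' y - b x' y0"
proof -
  obtain G G' where
    G: "\<And>p. p \<in> X \<times> Y \<Longrightarrow> GDERIV (\<lambda>(x, y). b x y) p :> G p"
    and contb: "continuous_on (closure X \<times> closure Y) (\<lambda>(x, y). b x y)"
    and contG: "continuous_on (closure X \<times> closure Y) G"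
    and G': "\<And>p. p \<in> X \<times> Y \<Longrightarrow> (G has_derivative blinfun_apply (G' p)) (at p)"
    and contG': "continuous_on (X \<times> Y) G'"
    and D_x: "\<And>x y. x \<in> closure X \<Longrightarrow> y \<in> closure Y \<Longrightarrow> D_x X Y b x y = fst (G (x, y))"
    and D_y: "\<And>x y. x \<in> closure X \<Longrightarrow> y \<in> closure Y \<Longrightarrow> D_y X Y b x y = snd (G (x, y))"
    and D2: "\<And>x y. x \<in> X \<Longrightarrow> y \<in> Y \<Longrightarrow> D2_xy X Y b x y = matrix (\<lambda>k. fst (G' (x, y) (0, k)))"
    using B0_gradientE[OF \<open>B0 X Y b\<close> \<open>open Y\<close>] by blast
  have subX: "x \<in> closure X" if "x \<in> X" for x
    using that closure_subset by blast
  have subY: "y \<in> closure Y" if "y \<in> Y" for y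
    using that closure_subset by blast
  have cpt: "compact (closure X \<times> closure Y)"
    using \<open>bounded X\<close> \<open>bounded Y\<close> by (simp add: compact_Times)
  have grad_x: "GDERIV (\<lambda>x'. b x' y) x :> fst (G (x, y))" if "x \<in> X" "y \<in> closure Y" for x y
  proof (rule GDERIV_boundary_parameter[OF \<open>open X\<close> that cpt contb])
    show "continuous_on (closure X \<times> closure Y) (\<lambda>p. fst (G p))"
      by (intro continuous_intros contG)
    show "GDERIV (\<lambda>x'. b x' y) x :> fst (G (x, y))" if "x \<in> X" "y \<in> Y" for x y
      using GDERIV_partial(1)[OF G[of "(x, y)"]] that by simp
  qed
  \<comment> \<open>The two mixed blocks of the Hessian at \<open>(x, y0)\<close>:
    \<open>M x\<close> differentiates the \<open>x\<close>-gradient in \<open>y\<close>, and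
    \<open>N x\<close> is the derivative of \<open>Q\<close>.\<close>
  define M where "M x k = fst (G' (x, y0) (0, k))" for x k
  define N where "N x h = snd (G' (x, y0) (h, 0))" for x h
  have linM: "linear (M x)" for x
    unfolding M_def
    by (intro bounded_linear.linear bounded_linear_intros)
  have linN: "bounded_linear (N x)" for x
    unfolding N_def by (intro bounded_linear_intros)
  have inj_M: "inj (M x)" if "x \<in> X" for x
  proof -
    \<comment> \<open>The minimum in (B1) is \<open>CARD('n)\<close> here, the number of
      columns.\<close>
    have "rank (matrix (M x)) = CARD('n)"
      using B1 that y0 subX subY D2[OF that y0] \<open>CARD('n) \<le> CARD('m)\<close>
      unfolding B1_def M_def by (metis min.absorb2)
    then have "inj ((*v) (matrix (M x)))"
      by (simp add: full_rank_injective)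
    then show ?thesis
      using linM[of x] by simp
  qed
  have M': "((\<lambda>y. fst (G (x, y))) has_derivative M x) (at y0)" if "x \<in> X" for x
  proof -
    have "((\<lambda>y'. (x, y')) has_derivative (\<lambda>k. (0, k))) (at y0)"
      by (auto intro!: derivative_eq_intros)
    from has_derivative_compose[OF this G'] show ?thesis
      unfolding M_def using that y0 by (auto intro: has_derivative_fst)
  qed
  \<comment> \<open>The tangent argument runs over all of \<open>closure Y\<close>, with boundary
    gradients supplied by \<open>grad_x\<close>; the base point \<open>y0\<close> is interior, so
    \<open>M x\<close> is a genuine derivative there.\<close>
  have tangent: "fst (G (x, y)) - fst (G (x, y0)) \<in> range (M x)" if "x \<in> X" for x
  proof (rule convex_image_subset_tangent_space[where K = "closure Y" and \<phi> = "\<lambda>y. fst (G (x, y))"])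
    show "compact (closure Y)"
      using \<open>bounded Y\<close> by simp
    show "continuous_on (closure Y) (\<lambda>y. fst (G (x, y)))"
      using subX[OF that] by (intro continuous_intros continuous_on_compose2[OF contG]) auto
    show "convex ((\<lambda>y. fst (G (x, y))) ` closure Y)"
      using grad_x[OF that] that
      by (intro convex_gradient_image[OF conv \<open>open X\<close> \<open>bounded X\<close> \<open>bounded Y\<close> \<open>y\<phi> \<in> closure Y\<close> contb])
    show "connected {w \<in> closure Y. fst (G (x, w)) = fst (G (x, y0))}"
    proof -
      have "connected {w \<in> closure Y. D_x X Y b x w = fst (G (x, y0))}"
        using B1 subX[OF that] subY[OF y0] unfolding B1_def by blast
      also have "{w \<in> closure Y. D_x X Y b x w = fst (G (x, y0))} =
          {w \<in> closure Y. fst (G (x, w)) = fst (G (x, y0))}"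
        using D_x subX[OF that] by auto
      finally show ?thesis .
    qed
  qed (use M'[OF that] inj_M[OF that] subY[OF y0] y in \<open>auto intro: has_derivative_at_withinI\<close>)
  \<comment> \<open>Symmetry of the full Hessian, tested on \<open>(h, 0)\<close> and
    \<open>(0, k)\<close>, makes the two blocks transposes of each other.\<close>
  have adjoint: "N x h \<bullet> k = h \<bullet> M x k" if "x \<in> X" for x h k
  proof -
    have "G' (x, y0) (h, 0) \<bullet> (0, k) = G' (x, y0) (0, k) \<bullet> (h, 0)"
      using second_derivative_symmetric[OF open_Times[OF \<open>open X\<close> \<open>open Y\<close>] _ G G'] that y0 by simp
    then show ?thesis
      by (simp add: M_def N_def inner_prod_def inner_commute)
  qed
  have surj_N: "surj (N x)" if "x \<in> X" for x
  proof -
    have "adjoint (M x) = N x"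
      using adjoint[OF that] by (intro adjoint_unique) (metis inner_commute)
    then show ?thesis
      using surj_adjoint_iff_inj[OF linM[of x]] inj_M[OF that] by simp
  qed
  define Q where "Q x = D_y X Y b x y0" for x
  have Q': "(Q has_derivative N x) (at x)" if "x \<in> X" for x
  proof -
    have "((\<lambda>x'. (x', y0)) has_derivative (\<lambda>h. (h, 0))) (at x)"
      by (auto intro!: derivative_eq_intros)
    from has_derivative_compose[OF this G']
    have "((\<lambda>x'. snd (G (x', y0))) has_derivative N x) (at x)"
      unfolding N_def using that y0 by (auto intro: has_derivative_snd)
    then show ?thesis
      by (rule has_derivative_transform_within_open[OF _ \<open>open X\<close> that])
        (simp add: Q_def D_y subX subY y0)
  qed
  have contN: "continuous_on X (\<lambda>x. Blinfun (N x))"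
  proof (rule continuous_on_blinfun_componentwise)
    fix h :: "real^'m"
    have "continuous_on X (\<lambda>x. snd (G' (x, y0) (h, 0)))"
      using y0 by (intro continuous_intros continuous_on_compose2[OF contG']) auto
    then show "continuous_on X (\<lambda>x. Blinfun (N x) h)"
      by (simp add: bounded_linear_Blinfun_apply[OF linN] N_def)
  qed
  have Qx: "Q x' = Q x"
    using x by (simp add: Q_def)
  show ?thesis
  proof (rule submersion_fibre_constant[OF \<open>open X\<close> _ contN _ _ _ _ x(1,2) refl Qx])
    show "(Q has_derivative Blinfun (N x)) (at x)" if "x \<in> X" for x
      using Q'[OF that] by (simp add: bounded_linear_Blinfun_apply[OF linN])
    show "((\<lambda>x. b x y - b x y0) has_derivative
        (\<lambda>h. h \<bullet> (fst (G (x, y)) - fst (G (x, y0))))) (at x)" if "x \<in> X" for x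
      using has_derivative_diff[OF grad_x[OF that y, unfolded gderiv_def]
          grad_x[OF that subY[OF y0], unfolded gderiv_def]]
      by (simp add: inner_diff_right)
    \<comment> \<open>Writing the gradient difference as \<open>M x k\<close>, its product with
      \<open>h\<close> is \<open>N x h \<bullet> k\<close>, which is zero.\<close>
    show "h \<bullet> (fst (G (x, y)) - fst (G (x, y0))) = 0" if "x \<in> X" "Blinfun (N x) h = 0" for x h
      using tangent[OF that(1)] adjoint[OF that(1), of h] that(2)
      by (auto simp: bounded_linear_Blinfun_apply[OF linN])
    show "surj (Blinfun (N x))" if "x \<in> X" for x
      using surj_N[OF that] by (simp add: bounded_linear_Blinfun_apply[OF linN])
    show "connected {z \<in> X. Q z = Q x}"
      using B1 subX[OF x(1)] subY[OF y0] unfolding B1_def Q_def by blast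
  qed
qed

section \<open>Effective preferences and change of variables\<close>

text \<open>The fibre contains \<open>x\<close>, so the choice picks one of its points, and by
  assumption every point gives the same value.\<close>

lemma effective_preference_eq:
  assumes "\<And>x'. x' \<in> X \<Longrightarrow> Q x' = Q x \<Longrightarrow> b x' y - b x' y0 = b x y - b x y0" and "x \<in> X"
  shows "effective_preference X Q b y0 (Q x) y = b x y - b x y0"
proof -
  have "\<exists>x'. x' \<in> X \<and> Q x' = Q x"
    using \<open>x \<in> X\<close> by blast
  then have "(SOME x'. x' \<in> X \<and> Q x' = Q x) \<in> X \<and> Q (SOME x'. x' \<in> X \<and> Q x' = Q x) = Q x"
    by (rule someI_ex)
  then show ?thesis
    using assms unfolding effective_preference_def Let_def by blast
qed

lemma ereal_shift_diff: "ereal (r + a) - e = (ereal r - e) + ereal a"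
  by (cases e) auto

lemma ereal_add_right_less_iff: "e + ereal a < e' + ereal a \<longleftrightarrow> e < e'"
  by (cases e; cases e') auto

text \<open>A real shift independent of the good leaves a supremum over a nonempty set. It is
  applied with \<open>a = b x y0\<close>.\<close>

lemma indirect_utility_shift:
  assumes "Y \<noteq> {}" and shift: "\<And>y. y \<in> closure Y \<Longrightarrow> b x y = h z y + a"
  shows "indirect_utility Y b v x = indirect_utility Y h v z + ereal a"
proof -
  have "indirect_utility Y b v x = (SUP y\<in>closure Y. (ereal (h z y) - v y) + ereal a)"
    unfolding indirect_utility_def by (intro SUP_cong refl) (simp add: shift ereal_shift_diff)
  also have "\<dots> = indirect_utility Y h v z + ereal a"
    unfolding indirect_utility_def using \<open>Y \<noteq> {}\<close> by (intro SUP_ereal_add_left) auto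
  finally show ?thesis .
qed

lemma optimal_goods_shift:
  assumes shift: "\<And>y. y \<in> closure Y \<Longrightarrow> b x y = h z y + a"
  shows "optimal_goods Y b v x = optimal_goods Y h v z"
proof -
  have "ereal (b x y) - v y < ereal (b x y') - v y' \<longleftrightarrow> ereal (h z y) - v y < ereal (h z y') - v y'"
    if "y \<in> closure Y" "y' \<in> closure Y" for y y'
    by (simp only: shift that ereal_shift_diff ereal_add_right_less_iff)
  then show ?thesis
    unfolding optimal_goods_def is_arg_max_def by auto
qed

text \<open>The shift enters both the preference and the utility and cancels; finiteness of the
  utility makes \<open>real_of_ereal\<close> additive.\<close>

lemma profit_integrand_shift:
  assumes "Y \<noteq> {}" and shift: "\<And>y. y \<in> closure Y \<Longrightarrow> b x y = h z y + a"
    and "good x \<in> closure Y" "good' z = good x" "\<bar>indirect_utility Y h v z\<bar> \<noteq> \<infinity>"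
  shows "profit_integrand Y b c v good x = profit_integrand Y h c v good' z"
  using assms(3-5) indirect_utility_shift[where b = b and h = h, OF assms(1,2), of v] shift
  by (auto simp: profit_integrand_def)

theorem corollary4p5:
  fixes X :: "(real^'m) set" and Y :: "(real^'n) set"
    and b :: "real^'m \<Rightarrow> real^'n \<Rightarrow> real"
    and c :: "real^'n \<Rightarrow> real" and y\<phi> :: "real^'n"
    and f :: "real^'m \<Rightarrow> ennreal" and \<mu> :: "(real^'m) measure"
  assumes "CARD('m) > CARD('n)"
    and "X \<noteq> {}" "open X" "bounded X"
    and "Y \<noteq> {}" "open Y" "bounded Y"
    and "B0 X Y b" and "B1 X Y b"
    and "y\<phi> \<in> closure Y"
    and "f \<in> borel_measurable (restrict_space lborel X)"
    and "\<mu> = density (restrict_space lborel X) f"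
    and "prob_space \<mu>"
  shows "\<not> convex_functions (U_b_phi X Y b c y\<phi>) \<or>
    (\<forall>y0\<in>Y.
      let Q = (\<lambda>x. D_y X Y b x y0);
          Z = Q ` X;
          h = effective_preference X Q b y0;
          \<nu> = distr \<mu> (restrict_space borel Z) Q
      in
        (\<forall>x\<in>X. \<forall>x'\<in>X. Q x = Q x' \<longrightarrow>
           (\<forall>y\<in>closure Y. b x y - b x y0 = b x' y - b x' y0)) \<and>
        (\<forall>x\<in>X. \<forall>y\<in>closure Y. h (Q x) y = b x y - b x y0) \<and>
        Q \<in> measurable \<mu> (restrict_space borel Z) \<and>
        (\<forall>v. price_schedule Y v \<longrightarrow>
           (\<forall>x\<in>X. indirect_utility Y b v x = indirect_utility Y h v (Q x) + ereal (b x y0)) \<and>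
           (\<forall>x\<in>X. optimal_goods Y b v x = optimal_goods Y h v (Q x)) \<and>
           (\<forall>good_b good_h.
              (\<forall>x\<in>X. \<bar>indirect_utility Y b v x\<bar> \<noteq> \<infinity>) \<and>
              (\<forall>z\<in>Z. \<bar>indirect_utility Y h v z\<bar> \<noteq> \<infinity>) \<and>
              (\<forall>x\<in>X. good_b x \<in> optimal_goods Y b v x) \<and>
              (\<forall>z\<in>Z. good_h z \<in> optimal_goods Y h v z) \<and>
              (\<forall>x\<in>X. good_b x = good_h (Q x)) \<and>
              integrable \<mu> (profit_integrand Y b c v good_b) \<and>
              integrable \<nu> (profit_integrand Y h c v good_h)
              \<longrightarrow> profit \<mu> Y b c v good_b = profit \<nu> Y h c v good_h)))"
proof (rule disj_imp[THEN iffD2], intro impI ballI)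
  fix y0
  assume "\<not> \<not> convex_functions (U_b_phi X Y b c y\<phi>)" and y0: "y0 \<in> Y"
  then have conv: "convex_functions (U_b_phi X Y b c y\<phi>)"
    by simp
  define Q where "Q = (\<lambda>x. D_y X Y b x y0)"
  define h where "h = effective_preference X Q b y0"
  define \<nu> where "\<nu> = distr \<mu> (restrict_space borel (Q ` X)) Q"
  have fibre: "b x y - b x y0 = b x' y - b x' y0"
    if "x \<in> X" "x' \<in> X" "Q x = Q x'" "y \<in> closure Y" for x x' y
    using preference_difference_constant_on_fibre[OF less_imp_le[OF assms(1)] assms(3,4,6-10) conv y0
        that(4,1,2) that(3)[unfolded Q_def]] .
  have h: "h (Q x) y = b x y - b x y0" if "x \<in> X" "y \<in> closure Y" for x y
    unfolding h_def
    by (rule effective_preference_eq[OF _ that(1)]) (rule fibre[OF _ that(1) _ that(2)])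
  have shift: "b x y = h (Q x) y + b x y0" if "x \<in> X" "y \<in> closure Y" for x y
    using h[OF that] by simp
  have space: "space \<mu> = X"
    by (simp add: assms space_restrict_space)
  have "y0 \<in> closure Y"
    using y0 closure_subset by blast
  then have "Q \<in> borel_measurable (restrict_space borel X)"
    unfolding Q_def using assms
    by (intro borel_measurable_continuous_on_restrict continuous_on_D_y)
  moreover have "sets \<mu> = sets (restrict_space borel X)"
    by (simp add: assms sets_restrict_space_cong[of lborel borel])
  ultimately have "Q \<in> borel_measurable \<mu>"
    using measurable_cong_sets by blast
  \<comment> \<open>The target carries the trace of the Borel sets on the image of \<open>X\<close>,
    so Borel measurability and the range of \<open>Q\<close> suffice, whether or not that image is
    Borel.\<close>
  then have Q: "Q \<in> measurable \<mu> (restrict_space borel (Q ` X))"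
    by (intro measurable_restrict_space2) (auto simp: space)
  have profit: "profit \<mu> Y b c v good_b = profit \<nu> Y h c v good_h"
    if finite: "\<forall>z\<in>Q ` X. \<bar>indirect_utility Y h v z\<bar> \<noteq> \<infinity>"
      and opt: "\<forall>x\<in>X. good_b x \<in> optimal_goods Y b v x"
      and good: "\<forall>x\<in>X. good_b x = good_h (Q x)"
      and int: "integrable \<nu> (profit_integrand Y h c v good_h)" for v good_b good_h
  proof -
    \<comment> \<open>Integrability under the pushforward \<open>\<nu>\<close> supplies the
      measurability that the change of variables requires.\<close>
    have "profit_integrand Y h c v good_h \<in> borel_measurable (restrict_space borel (Q ` X))"
      using borel_measurable_integrable[OF int] by (simp add: \<nu>_def)
    then have "profit \<nu> Y h c v good_h = (LINT x|\<mu>. profit_integrand Y h c v good_h (Q x))"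
      unfolding profit_def \<nu>_def by (rule integral_distr[OF Q])
    also have "\<dots> = profit \<mu> Y b c v good_b"
      unfolding profit_def
    proof (rule Bochner_Integration.integral_cong[OF refl])
      fix x
      assume "x \<in> space \<mu>"
      then have x: "x \<in> X"
        by (simp add: space)
      \<comment> \<open>Optimality includes membership in \<open>closure Y\<close>, where
        \<open>shift\<close> holds.\<close>
      then have "good_b x \<in> closure Y"
        using opt by (auto simp: optimal_goods_def is_arg_max_def)
      then show "profit_integrand Y h c v good_h (Q x) = profit_integrand Y b c v good_b x"
        using profit_integrand_shift[where b = b and h = h, OF \<open>Y \<noteq> {}\<close> shift[OF x]] finite good x
        by simp
    qed
    finally show ?thesis by simp
  qed
  show "let Q = (\<lambda>x. D_y X Y b x y0);
          Z = Q ` X;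
          h = effective_preference X Q b y0;
          \<nu> = distr \<mu> (restrict_space borel Z) Q
      in
        (\<forall>x\<in>X. \<forall>x'\<in>X. Q x = Q x' \<longrightarrow>
           (\<forall>y\<in>closure Y. b x y - b x y0 = b x' y - b x' y0)) \<and>
        (\<forall>x\<in>X. \<forall>y\<in>closure Y. h (Q x) y = b x y - b x y0) \<and>
        Q \<in> measurable \<mu> (restrict_space borel Z) \<and>
        (\<forall>v. price_schedule Y v \<longrightarrow>
           (\<forall>x\<in>X. indirect_utility Y b v x = indirect_utility Y h v (Q x) + ereal (b x y0)) \<and>
           (\<forall>x\<in>X. optimal_goods Y b v x = optimal_goods Y h v (Q x)) \<and>
           (\<forall>good_b good_h.
              (\<forall>x\<in>X. \<bar>indirect_utility Y b v x\<bar> \<noteq> \<infinity>) \<and>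
              (\<forall>z\<in>Z. \<bar>indirect_utility Y h v z\<bar> \<noteq> \<infinity>) \<and>
              (\<forall>x\<in>X. good_b x \<in> optimal_goods Y b v x) \<and>
              (\<forall>z\<in>Z. good_h z \<in> optimal_goods Y h v z) \<and>
              (\<forall>x\<in>X. good_b x = good_h (Q x)) \<and>
              integrable \<mu> (profit_integrand Y b c v good_b) \<and>
              integrable \<nu> (profit_integrand Y h c v good_h)
              \<longrightarrow> profit \<mu> Y b c v good_b = profit \<nu> Y h c v good_h))"
    unfolding Let_def Q_def[symmetric] h_def[symmetric] \<nu>_def[symmetric]
  proof (intro conjI ballI allI impI)
    show "b x y - b x y0 = b x' y - b x' y0"
      if "x \<in> X" "x' \<in> X" "Q x = Q x'" "y \<in> closure Y" for x x' y
      by (rule fibre[OF that])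
    show "h (Q x) y = b x y - b x y0" if "x \<in> X" "y \<in> closure Y" for x y
      by (rule h[OF that])
    show "Q \<in> measurable \<mu> (restrict_space borel (Q ` X))"
      by (rule Q)
    show "indirect_utility Y b v x = indirect_utility Y h v (Q x) + ereal (b x y0)" if "x \<in> X" for v x
      by (rule indirect_utility_shift[OF \<open>Y \<noteq> {}\<close>]) (rule shift[OF that])
    show "optimal_goods Y b v x = optimal_goods Y h v (Q x)" if "x \<in> X" for v x
      by (rule optimal_goods_shift) (rule shift[OF that])
  qed (elim conjE, rule profit)
qed

end
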